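(* Let $B$ be a simply connected non-empty Alexandroff space and let $p$ be a fiber bundle over $B$. Then $p$ is a trivial fiber bundle.
   Context: An Alexandroff space is a topological space in which arbitrary intersections of open sets are open. Simply connected means path-connected with trivial fundamental group. A fiber bundle over $B$ (with fiber a topological space $F$) is a continuous map $p\colon E\to B$ such that every $b\in B$ has an open neighbourhood $U$ with a homeomorphism $p^{-1}(U)\to U\times F$ commuting with the maps to $U$. It is trivial if there is a homeomorphism $E\to B\times F$ commuting with $p$ and the projection $B\times F\to B$. *)

theory Defs
  imports "HOL-Analysis.Analysis"
begin

definition Alexandroff_space :: "'a topology \<Rightarrow> bool" where
  "Alexandroff_space X \<longleftrightarrow>
     (\<forall>\<U>. \<U> \<noteq> {} \<and> (\<forall>U\<in>\<U>. openin X U) \<longrightarrow> openin X (\<Inter>\<U>))"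

text \<open>
  Loops are maps on the reals of which only the values on \<open>{0..1}\<close> matter; \<open>loop_homotopic\<close> is
  homotopy relative to the endpoints, and identifies maps that agree on \<open>{0..1}\<close>.
  The library's \<open>simply_connected\<close> is not used, since it concerns subsets of a type of class
  \<open>topological_space\<close> rather than abstract topologies.
\<close>

definition loops_at :: "'a topology \<Rightarrow> 'a \<Rightarrow> (real \<Rightarrow> 'a) set" where
  "loops_at X x = {g. pathin X g \<and> g 0 = x \<and> g 1 = x}"

definition loop_homotopic :: "'a topology \<Rightarrow> 'a \<Rightarrow> ((real \<Rightarrow> 'a) \<times> (real \<Rightarrow> 'a)) set" where
  "loop_homotopic X x =
     {(f, g). homotopic_with (\<lambda>r. r 0 = x \<and> r 1 = x) (top_of_set {0..1}) X f g}"

lemma equiv_loop_homotopic: "equiv (loops_at X x) (loop_homotopic X x)"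
proof (rule equivI)
  have "f \<in> loops_at X x \<and> g \<in> loops_at X x" if "(f, g) \<in> loop_homotopic X x" for f g
  proof -
    have h: "homotopic_with (\<lambda>r. r 0 = x \<and> r 1 = x) (top_of_set {0..1}) X f g"
      using that by (simp add: loop_homotopic_def)
    show ?thesis
      using homotopic_with_imp_continuous_maps[OF h] homotopic_with_imp_property[OF h]
      by (simp add: loops_at_def pathin_def)
  qed
  then show "loop_homotopic X x \<subseteq> loops_at X x \<times> loops_at X x"
    by auto
  show "refl_on (loops_at X x) (loop_homotopic X x)"
    by (simp add: refl_on_def loop_homotopic_def loops_at_def pathin_def)
  show "sym (loop_homotopic X x)"
    by (simp add: sym_def loop_homotopic_def homotopic_with_sym)
  show "trans (loop_homotopic X x)"
    unfolding trans_def loop_homotopic_def by (blast intro: homotopic_with_trans)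
qed

text \<open>The underlying set of the fundamental group at \<open>x\<close>, which decides whether the group is
  trivial.\<close>

definition fundamental_group_carrier :: "'a topology \<Rightarrow> 'a \<Rightarrow> (real \<Rightarrow> 'a) set set" where
  "fundamental_group_carrier X x = loops_at X x // loop_homotopic X x"

definition simply_connected_space :: "'a topology \<Rightarrow> bool" where
  "simply_connected_space X \<longleftrightarrow>
     path_connected_space X \<and>
     (\<forall>x\<in>topspace X. fundamental_group_carrier X x = {loop_homotopic X x `` {\<lambda>_. x}})"

definition trivial_fiber_bundle ::
    "'e topology \<Rightarrow> 'b topology \<Rightarrow> 'f topology \<Rightarrow> ('e \<Rightarrow> 'b) \<Rightarrow> bool" where
  "trivial_fiber_bundle E B F p \<longleftrightarrow>
     (\<exists>h. homeomorphic_map E (prod_topology B F) h \<and> (\<forall>e\<in>topspace E. fst (h e) = p e))"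

definition fiber_bundle ::
    "'e topology \<Rightarrow> 'b topology \<Rightarrow> 'f topology \<Rightarrow> ('e \<Rightarrow> 'b) \<Rightarrow> bool" where
  "fiber_bundle E B F p \<longleftrightarrow>
     continuous_map E B p \<and>
     (\<forall>b\<in>topspace B. \<exists>U. openin B U \<and> b \<in> U \<and>
        trivial_fiber_bundle (subtopology E {e \<in> topspace E. p e \<in> U}) (subtopology B U) F p)"

end

(*
  In an Alexandroff space every point b has a smallest open neighbourhood U b, over which the bundle
  is trivial.  A continuous map on U b x F is controlled by its restriction to {b} x F, so two
  trivialisations over U b whose restrictions to one fibre agree up to topological
  indistinguishability agree in this sense on all of U b.  Hence the frames (homeomorphisms from F
  onto a fibre), taken modulo indistinguishability, form a canonical local system on B.  A local
  system on a simply connected space has no monodromy, so it has a global section.  Frames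
  representing such a section may be chosen independently at each point, since open sets do not see
  the difference; they assemble to a homeomorphism B x F -> E.
*)

theory Submission
  imports Defs
begin

section \<open>Smallest neighbourhoods\<close>

text \<open>Indistinguishability enters because \<open>F\<close> need not be T0. Let
  \<open>B\<close> be the Sierpinski space and \<open>F\<close> the indiscrete space on two points:
  the map of B x F that swaps \<open>F\<close> over the open point and fixes it over the closed
  point is a bundle automorphism. So a frame over the closed point, whose smallest neighbourhood is
  all of \<open>B\<close>, does not determine one over the open point; only the class modulo
  indistinguishability is determined. For classes, passing from \<open>b\<close> to a point
  \<open>x\<close> of its smallest neighbourhood is a bijection: it is injective because a
  trivialisation lets open sets at \<open>b\<close> be tested at \<open>x\<close>, and surjective
  because a frame over \<open>x\<close> extends over the whole neighbourhood by an automorphism of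
  \<open>F\<close> that does not vary with the base point. Since simple connectedness is a statement
  about loops and homotopies, the section is found by lifting paths. A lift is a function satisfying
  a local condition, so the covering space with these fibres never has to be given a topology, and
  compactness of the interval enters through bisection (\<open>Bolzano\<close>).\<close>

definition min_nbhd :: "'a topology \<Rightarrow> 'a \<Rightarrow> 'a set" where
  "min_nbhd X x = \<Inter>{V. openin X V \<and> x \<in> V}"

lemma in_min_nbhd [simp]: "x \<in> min_nbhd X x"
  by (auto simp: min_nbhd_def)

lemma min_nbhd_subset: "openin X V \<Longrightarrow> x \<in> V \<Longrightarrow> min_nbhd X x \<subseteq> V"
  by (auto simp: min_nbhd_def)

lemma openin_min_nbhd:
  assumes "Alexandroff_space X" "x \<in> topspace X"
  shows "openin X (min_nbhd X x)"
proof -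
  have "{V. openin X V \<and> x \<in> V} \<noteq> {}"
    using assms(2) by blast
  then show ?thesis
    using assms(1)[unfolded Alexandroff_space_def, rule_format, of "{V. openin X V \<and> x \<in> V}"]
    by (simp add: min_nbhd_def)
qed

lemma min_nbhd_mono:
  assumes "Alexandroff_space X" "x \<in> topspace X" "y \<in> min_nbhd X x"
  shows "min_nbhd X y \<subseteq> min_nbhd X x"
  using assms openin_min_nbhd min_nbhd_subset by metis

lemma min_nbhd_topspace:
  assumes "x \<in> topspace X" "y \<in> min_nbhd X x"
  shows "y \<in> topspace X"
  using assms(2) min_nbhd_subset[OF openin_topspace assms(1)] by (rule rev_subsetD)

lemma eventually_at_withinI_openin:
  assumes "openin (top_of_set S) A" "t \<in> A"
  shows "\<forall>\<^sub>F t' in at t within S. t' \<in> A"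
  using assms by (auto simp: openin_subtopology eventually_at_topological)

text \<open>One neighbourhood of \<open>g t\<close> suffices as a test, so continuity becomes an
  "eventually" statement about a single set. That \<open>at t within S\<close> omits
  \<open>t\<close> does no harm, since \<open>g t\<close> lies in
  \<open>min_nbhd X (g t)\<close>.\<close>

lemma continuous_map_Alexandroff_iff:
  fixes g :: "'c::topological_space \<Rightarrow> 'b"
  assumes "Alexandroff_space X"
  shows "continuous_map (top_of_set S) X g \<longleftrightarrow>
    (\<forall>t\<in>S. g t \<in> topspace X \<and> (\<forall>\<^sub>F t' in at t within S. g t' \<in> min_nbhd X (g t)))"
    (is "?L \<longleftrightarrow> ?R")
proof
  assume L: ?L
  show ?R
  proof
    fix t assume t: "t \<in> S"
    then have gt: "g t \<in> topspace X"
      using L by (auto simp: continuous_map_def)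
    have "openin (top_of_set S) {s \<in> S. g s \<in> min_nbhd X (g t)}"
      using openin_continuous_map_preimage[OF L openin_min_nbhd[OF assms gt]] by simp
    then have "\<forall>\<^sub>F t' in at t within S. t' \<in> {s \<in> S. g s \<in> min_nbhd X (g t)}"
      by (rule eventually_at_withinI_openin) (simp add: t in_min_nbhd)
    then show "g t \<in> topspace X \<and> (\<forall>\<^sub>F t' in at t within S. g t' \<in> min_nbhd X (g t))"
      using gt by (auto elim: eventually_mono)
  qed
next
  assume R: ?R
  have "openin (top_of_set S) {s \<in> S. g s \<in> V}" if V: "openin X V" for V
  proof (subst openin_subopen, intro ballI)
    fix t assume "t \<in> {s \<in> S. g s \<in> V}"
    then have t: "t \<in> S" "g t \<in> V" by auto
    obtain A where A: "open A" "t \<in> A" "\<And>s. s \<in> A \<Longrightarrow> s \<noteq> t \<Longrightarrow> s \<in> S \<Longrightarrow> g s \<in> min_nbhd X (g t)"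
      using R t(1) unfolding eventually_at_topological by metis
    have "g s \<in> V" if "s \<in> S \<inter> A" for s
      using A(3)[of s] that t(2) min_nbhd_subset[OF V t(2)] by (cases "s = t") auto
    then show "\<exists>T. openin (top_of_set S) T \<and> t \<in> T \<and> T \<subseteq> {s \<in> S. g s \<in> V}"
      using A(1,2) t(1) by (intro exI[of _ "S \<inter> A"]) auto
  qed
  then show ?L
    using R by (auto simp: continuous_map_def)
qed

section \<open>Local systems on Alexandroff spaces\<close>

text \<open>The preorder \<open>x \<in> min_nbhd B b\<close> is viewed as a category; a local system
  is a functor from it to sets and bijections. \<open>T\<close> is constrained only in the direction
  from \<open>b\<close> into its smallest neighbourhood.\<close>

locale local_system =
  fixes B :: "'b topology" and Q :: "'b \<Rightarrow> 'q set" and T :: "'b \<Rightarrow> 'b \<Rightarrow> 'q \<Rightarrow> 'q"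
  assumes alex: "Alexandroff_space B"
    and bij: "\<And>b x. b \<in> topspace B \<Longrightarrow> x \<in> min_nbhd B b \<Longrightarrow> bij_betw (T b x) (Q b) (Q x)"
    and T_id: "\<And>b q. b \<in> topspace B \<Longrightarrow> q \<in> Q b \<Longrightarrow> T b b q = q"
    and T_comp: "\<And>b x y q. b \<in> topspace B \<Longrightarrow> x \<in> min_nbhd B b \<Longrightarrow> y \<in> min_nbhd B x \<Longrightarrow>
      q \<in> Q b \<Longrightarrow> T x y (T b x q) = T b y q"
begin

text \<open>A flat section \<open>\<sigma>\<close> along \<open>\<gamma>\<close> is a lift of \<open>\<gamma>\<close> to the covering space with fibres \<open>Q b\<close>;
  flatness includes the continuity of \<open>\<gamma>\<close>.\<close>

definition flat :: "real set \<Rightarrow> (real \<Rightarrow> 'b) \<Rightarrow> (real \<Rightarrow> 'q) \<Rightarrow> bool" where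
  "flat S \<gamma> \<sigma> \<longleftrightarrow> (\<forall>t\<in>S. \<gamma> t \<in> topspace B \<and> \<sigma> t \<in> Q (\<gamma> t) \<and>
     (\<forall>\<^sub>F t' in at t within S. \<gamma> t' \<in> min_nbhd B (\<gamma> t) \<and> \<sigma> t' = T (\<gamma> t) (\<gamma> t') (\<sigma> t)))"

lemma T_in:
  "b \<in> topspace B \<Longrightarrow> x \<in> min_nbhd B b \<Longrightarrow> q \<in> Q b \<Longrightarrow> T b x q \<in> Q x"
  using bij bij_betwE by blast

lemma T_inj:
  "b \<in> topspace B \<Longrightarrow> x \<in> min_nbhd B b \<Longrightarrow> q \<in> Q b \<Longrightarrow> r \<in> Q b \<Longrightarrow> T b x q = T b x r \<longleftrightarrow> q = r"
  using bij bij_betw_imp_inj_on inj_on_eq_iff by metis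

lemma T_surj:
  assumes "b \<in> topspace B" "x \<in> min_nbhd B b" "q \<in> Q x"
  obtains r where "r \<in> Q b" "q = T b x r"
  using bij[OF assms(1,2)] assms(3) by (metis bij_betw_def imageE)

lemma flat_imp_continuous: "flat S \<gamma> \<sigma> \<Longrightarrow> continuous_map (top_of_set S) B \<gamma>"
  unfolding continuous_map_Alexandroff_iff[OF alex] flat_def
  by (auto elim: eventually_mono)

lemma flat_in:
  "flat S \<gamma> \<sigma> \<Longrightarrow> t \<in> S \<Longrightarrow> \<gamma> t \<in> topspace B"
  "flat S \<gamma> \<sigma> \<Longrightarrow> t \<in> S \<Longrightarrow> \<sigma> t \<in> Q (\<gamma> t)"
  by (auto simp: flat_def)

lemma flat_subset:
  assumes "flat S \<gamma> \<sigma>" "R \<subseteq> S" shows "flat R \<gamma> \<sigma>"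
  using assms unfolding flat_def by (meson at_le filter_leD subsetD)

lemma flat_cong:
  assumes "flat S \<gamma> \<sigma>" "\<And>t. t \<in> S \<Longrightarrow> \<gamma> t = \<gamma>' t" "\<And>t. t \<in> S \<Longrightarrow> \<sigma> t = \<sigma>' t"
  shows "flat S \<gamma>' \<sigma>'"
  unfolding flat_def
proof
  fix t assume t: "t \<in> S"
  have "\<forall>\<^sub>F t' in at t within S. t' \<in> S"
    by (auto simp: eventually_at_topological)
  moreover have "\<forall>\<^sub>F t' in at t within S. \<gamma> t' \<in> min_nbhd B (\<gamma> t) \<and> \<sigma> t' = T (\<gamma> t) (\<gamma> t') (\<sigma> t)"
    using assms(1) t by (simp add: flat_def)
  ultimately have "\<forall>\<^sub>F t' in at t within S. \<gamma>' t' \<in> min_nbhd B (\<gamma>' t) \<and> \<sigma>' t' = T (\<gamma>' t) (\<gamma>' t') (\<sigma>' t)"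
    by eventually_elim (use assms t in auto)
  then show "\<gamma>' t \<in> topspace B \<and> \<sigma>' t \<in> Q (\<gamma>' t) \<and>
     (\<forall>\<^sub>F t' in at t within S. \<gamma>' t' \<in> min_nbhd B (\<gamma>' t) \<and> \<sigma>' t' = T (\<gamma>' t) (\<gamma>' t') (\<sigma>' t))"
    using flat_in[OF assms(1) t] assms(2,3)[OF t] by simp
qed

lemma flat_reparam:
  assumes fl: "flat R \<gamma> \<sigma>" and \<phi>: "continuous_on S \<phi>" "\<phi> ` S \<subseteq> R"
  shows "flat S (\<gamma> \<circ> \<phi>) (\<sigma> \<circ> \<phi>)"
  unfolding flat_def o_def
proof (intro ballI conjI)
  fix t assume t: "t \<in> S"
  then have R: "\<phi> t \<in> R" using \<phi> by auto
  show 1: "\<gamma> (\<phi> t) \<in> topspace B" "\<sigma> (\<phi> t) \<in> Q (\<gamma> (\<phi> t))"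
    using flat_in[OF fl R] by auto
  let ?P = "\<lambda>u. \<gamma> u \<in> min_nbhd B (\<gamma> (\<phi> t)) \<and> \<sigma> u = T (\<gamma> (\<phi> t)) (\<gamma> u) (\<sigma> (\<phi> t))"
  have "\<forall>\<^sub>F u in at (\<phi> t) within R. ?P u"
    using fl R by (simp add: flat_def)
  then obtain A where A: "open A" "\<phi> t \<in> A" "\<And>u. u \<in> A \<Longrightarrow> u \<noteq> \<phi> t \<Longrightarrow> u \<in> R \<Longrightarrow> ?P u"
    unfolding eventually_at_topological by metis
  \<comment> \<open>\<open>\<phi>\<close> may return to the value \<open>\<phi> t\<close> at points
    other than \<open>t\<close>, which the punctured filter does not cover; there
    \<open>T_id\<close> gives the claim.\<close>
  have P: "?P u" if "u \<in> A" "u \<in> R" for u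
    using A(3)[of u] that 1 T_id in_min_nbhd by (cases "u = \<phi> t") auto
  have "\<forall>\<^sub>F t' in at t within S. \<phi> t' \<in> A"
    using \<phi>(1) t A(1,2) by (auto simp: continuous_on_def intro: topological_tendstoD)
  moreover have "\<forall>\<^sub>F t' in at t within S. t' \<in> S"
    by (auto simp: eventually_at_topological)
  ultimately show "\<forall>\<^sub>F t' in at t within S. ?P (\<phi> t')"
    by eventually_elim (use P \<phi>(2) in blast)
qed

lemma flat_join:
  assumes "flat {a..b} \<gamma> \<sigma>" "flat {b..c} \<gamma> \<sigma>" "a \<le> b" "b \<le> c"
  shows "flat {a..c} \<gamma> \<sigma>"
proof -
  have eq: "{a..c} = {a..b} \<union> {b..c}" using assms(3,4) by auto
  have *: "\<forall>\<^sub>F t' in at t within S. \<gamma> t' \<in> min_nbhd B (\<gamma> t) \<and> \<sigma> t' = T (\<gamma> t) (\<gamma> t') (\<sigma> t)"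
    if "flat S \<gamma> \<sigma>" "closed S" for S t
  proof (cases "t \<in> S")
    case True
    then show ?thesis using that by (simp add: flat_def)
  next
    case False
    \<comment> \<open>A point of the union lying in only one of the two intervals puts no condition
      on the other one, because the filter there is trivial.\<close>
    then have "at t within S = bot"
      using that(2) by (simp add: at_within_eq_bot_iff)
    then show ?thesis by simp
  qed
  show ?thesis
    using flat_in[OF assms(1)] flat_in[OF assms(2)] *[OF assms(1)] *[OF assms(2)]
    unfolding flat_def eq by (auto simp: at_within_union eventually_sup)
qed

section \<open>Uniqueness and existence of lifts along a path\<close>

text \<open>Since the maps \<open>T\<close> are injective, disagreement spreads to nearby points
  just as agreement does. Hence agreement is locally constant on the connected set
  \<open>S\<close>.\<close>

lemma flat_unique:
  assumes "connected S" "flat S \<gamma> \<sigma>" "flat S \<gamma> \<tau>" "a \<in> S" "t \<in> S" "\<sigma> a = \<tau> a"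
  shows "\<sigma> t = \<tau> t"
proof -
  have "\<forall>\<^sub>F v in at u within S. (\<sigma> u = \<tau> u) = (\<sigma> v = \<tau> v)" if u: "u \<in> S" for u
  proof -
    have "\<forall>\<^sub>F v in at u within S. \<gamma> v \<in> min_nbhd B (\<gamma> u) \<and> \<sigma> v = T (\<gamma> u) (\<gamma> v) (\<sigma> u)"
      "\<forall>\<^sub>F v in at u within S. \<gamma> v \<in> min_nbhd B (\<gamma> u) \<and> \<tau> v = T (\<gamma> u) (\<gamma> v) (\<tau> u)"
      using assms(2,3) u by (auto simp: flat_def)
    then show ?thesis
      by eventually_elim
        (use T_inj flat_in[OF assms(2) u] flat_in[OF assms(3) u] in metis)
  qed
  then have "(\<sigma> a = \<tau> a) = (\<sigma> t = \<tau> t)"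
    using connected_local_const[OF assms(1,4,5), of "\<lambda>u. \<sigma> u = \<tau> u"] by simp
  then show ?thesis using assms(6) by simp
qed

text \<open>Inside one smallest neighbourhood a lift is obtained by transporting a single element
  from the centre \<open>c\<close>; its flatness is \<open>T_comp\<close>.\<close>

lemma flat_local:
  assumes \<gamma>: "continuous_map (top_of_set S) B \<gamma>" and c: "c \<in> topspace B" "\<gamma> ` S \<subseteq> min_nbhd B c"
    and r: "r \<in> Q c"
  shows "flat S \<gamma> (\<lambda>t. T c (\<gamma> t) r)"
  unfolding flat_def
proof (intro ballI conjI)
  fix t assume t: "t \<in> S"
  show "\<gamma> t \<in> topspace B" "T c (\<gamma> t) r \<in> Q (\<gamma> t)"
    using t c r min_nbhd_topspace T_in by (metis image_subset_iff)+
  have "\<forall>\<^sub>F t' in at t within S. \<gamma> t' \<in> min_nbhd B (\<gamma> t)"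
    using \<gamma> t by (simp add: continuous_map_Alexandroff_iff[OF alex])
  then show "\<forall>\<^sub>F t' in at t within S. \<gamma> t' \<in> min_nbhd B (\<gamma> t) \<and>
      T c (\<gamma> t') r = T (\<gamma> t) (\<gamma> t') (T c (\<gamma> t) r)"
    by eventually_elim (use T_comp c r t in auto)
qed

lemma flat_local_unique:
  assumes fl: "flat {a..b} \<gamma> \<sigma>" and ab: "a \<le> b"
    and c: "c \<in> topspace B" "\<gamma> ` {a..b} \<subseteq> min_nbhd B c"
    and r: "r \<in> Q c" "\<sigma> a = T c (\<gamma> a) r"
  shows "\<sigma> b = T c (\<gamma> b) r"
  using flat_unique[OF connected_Icc fl flat_local[OF flat_imp_continuous[OF fl] c r(1)], of a b] ab r
  by simp

lemma flat_exists:
  assumes "a \<le> b" "continuous_map (top_of_set {a..b}) B \<gamma>" "q \<in> Q (\<gamma> a)"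
  shows "\<exists>\<sigma>. flat {a..b} \<gamma> \<sigma> \<and> \<sigma> a = q"
proof -
  \<comment> \<open>All starting values are allowed, because the second of two adjacent pieces has
    to start wherever the first one ends.\<close>
  let ?P = "\<lambda>u v. a \<le> u \<longrightarrow> u \<le> v \<longrightarrow> v \<le> b \<longrightarrow> (\<forall>q\<in>Q (\<gamma> u). \<exists>\<sigma>. flat {u..v} \<gamma> \<sigma> \<and> \<sigma> u = q)"
  have "?P a b"
    using assms(1)
  proof (rule Bolzano[where P = "?P"])
    fix u v w assume trans: "?P u v" "?P v w" "u \<le> v" "v \<le> w"
    show "?P u w"
    proof (intro impI ballI)
      fix q assume *: "a \<le> u" "u \<le> w" "w \<le> b" "q \<in> Q (\<gamma> u)"
      then obtain \<sigma> where \<sigma>: "flat {u..v} \<gamma> \<sigma>" "\<sigma> u = q"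
        using trans by (meson order_trans)
      then have "\<sigma> v \<in> Q (\<gamma> v)" using trans(3) by (auto simp: flat_def)
      then obtain \<tau> where \<tau>: "flat {v..w} \<gamma> \<tau>" "\<tau> v = \<sigma> v"
        using trans * by (meson order_trans)
      let ?\<rho> = "\<lambda>t. if t \<le> v then \<sigma> t else \<tau> t"
      have "flat {u..w} \<gamma> ?\<rho>"
      proof (rule flat_join[OF _ _ trans(3,4)])
        show "flat {u..v} \<gamma> ?\<rho>" by (rule flat_cong[OF \<sigma>(1)]) auto
        show "flat {v..w} \<gamma> ?\<rho>" by (rule flat_cong[OF \<tau>(1)]) (use \<tau>(2) in auto)
      qed
      then show "\<exists>\<sigma>. flat {u..w} \<gamma> \<sigma> \<and> \<sigma> u = q"
        using \<sigma>(2) trans(3) by (intro exI[of _ ?\<rho>]) auto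
    qed
  next
    fix x assume local: "a \<le> x" "x \<le> b"
    have x: "\<gamma> x \<in> topspace B" "\<forall>\<^sub>F t in at x within {a..b}. \<gamma> t \<in> min_nbhd B (\<gamma> x)"
      using assms(2) local by (auto simp: continuous_map_Alexandroff_iff[OF alex])
    then obtain d where d: "d > 0" "\<And>t. t \<in> {a..b} \<Longrightarrow> t \<noteq> x \<Longrightarrow> dist t x < d \<Longrightarrow> \<gamma> t \<in> min_nbhd B (\<gamma> x)"
      unfolding eventually_at by metis
    have d': "\<gamma> t \<in> min_nbhd B (\<gamma> x)" if "t \<in> {a..b}" "\<bar>t - x\<bar> < d" for t
      using d(2)[of t] that by (cases "t = x") (auto simp: in_min_nbhd dist_real_def)
    have "?P u v" if uv: "u \<le> x" "x \<le> v" "v - u < d" for u v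
    proof (intro impI ballI)
      fix q assume *: "a \<le> u" "u \<le> v" "v \<le> b" "q \<in> Q (\<gamma> u)"
      have sub: "\<gamma> ` {u..v} \<subseteq> min_nbhd B (\<gamma> x)"
        using d' uv * by auto
      then have "\<gamma> u \<in> min_nbhd B (\<gamma> x)" using *(2) by auto
      \<comment> \<open>The centre \<open>x\<close> lies somewhere between \<open>u\<close> and
        \<open>v\<close>, so the prescribed value at \<open>u\<close> is first pulled back to the
        centre, using surjectivity of \<open>T\<close>.\<close>
      then obtain r where r: "r \<in> Q (\<gamma> x)" "q = T (\<gamma> x) (\<gamma> u) r"
        using T_surj[OF x(1)] *(4) by blast
      have "continuous_map (top_of_set {u..v}) B \<gamma>"
        using assms(2) * by (intro continuous_map_from_subtopology_mono[OF assms(2)]) auto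
      from flat_local[OF this x(1) sub r(1)]
      show "\<exists>\<sigma>. flat {u..v} \<gamma> \<sigma> \<and> \<sigma> u = q"
        using r(2) by blast
    qed
    with d(1) show "\<exists>d>0. \<forall>u v. u \<le> x \<and> x \<le> v \<and> v - u < d \<longrightarrow> ?P u v"
      by (intro exI[of _ d]) simp
  qed
  then show ?thesis using assms by auto
qed

section \<open>Homotopy invariance of transport and triviality of monodromy\<close>

text \<open>Continuity on the square, with a neighbourhood of product shape: one bound on
  \<open>s'\<close> then serves a whole interval of values \<open>t'\<close>. Half the metric radius
  is taken because the distance is at most the sum of the two coordinate differences.\<close>

lemma homotopy_box:
  assumes H: "continuous_map (prod_topology (top_of_set {0..1}) (top_of_set {0..1})) B H"
    and st: "s \<in> {0..1::real}" "t \<in> {0..1::real}"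
  shows "H (s, t) \<in> topspace B \<and> (\<exists>e>0. \<forall>s'\<in>{0..1}. \<forall>t'\<in>{0..1}. \<bar>s' - s\<bar> < e \<longrightarrow> \<bar>t' - t\<bar> < e \<longrightarrow>
    H (s', t') \<in> min_nbhd B (H (s, t)))"
proof
  have H': "continuous_map (top_of_set ({0..1} \<times> {0..1})) B H"
    using H by (simp add: subtopology_Times flip: euclidean_product_topology)
  then show "H (s, t) \<in> topspace B"
    using st by (auto simp: continuous_map_Alexandroff_iff[OF alex])
  have "\<forall>\<^sub>F z in at (s, t) within {0..1} \<times> {0..1}. H z \<in> min_nbhd B (H (s, t))"
    using H' st by (auto simp: continuous_map_Alexandroff_iff[OF alex])
  then obtain d where d: "d > 0" "\<And>z. z \<in> {0..1} \<times> {0..1} \<Longrightarrow> z \<noteq> (s, t) \<Longrightarrow> dist z (s, t) < d \<Longrightarrow>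
      H z \<in> min_nbhd B (H (s, t))"
    unfolding eventually_at by metis
  have "H (s', t') \<in> min_nbhd B (H (s, t))"
    if "s' \<in> {0..1}" "t' \<in> {0..1}" "\<bar>s' - s\<bar> < d / 2" "\<bar>t' - t\<bar> < d / 2" for s' t'
  proof (cases "(s', t') = (s, t)")
    case False
    have "dist (s', t') (s, t) \<le> \<bar>s' - s\<bar> + \<bar>t' - t\<bar>"
      by (simp add: dist_Pair_Pair dist_real_def sqrt_sum_squares_le_sum_abs)
    then show ?thesis using d(2)[of "(s', t')"] False that by auto
  qed (auto simp: in_min_nbhd)
  then show "\<exists>e>0. \<forall>s'\<in>{0..1}. \<forall>t'\<in>{0..1}. \<bar>s' - s\<bar> < e \<longrightarrow> \<bar>t' - t\<bar> < e \<longrightarrow>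
    H (s', t') \<in> min_nbhd B (H (s, t))"
    using d(1) by (intro exI[of _ "d / 2"]) auto
qed

text \<open>The end points are allowed to move, so that the statement can be concatenated along a
  subdivision of the path.\<close>

lemma transport_homotopy:
  assumes H: "continuous_map (prod_topology (top_of_set {0..1}) (top_of_set {0..1})) B H"
    and s0: "s0 \<in> {0..1::real}"
  shows "\<forall>\<^sub>F s in at s0 within {0..1}. \<forall>\<sigma> \<tau>.
    flat {0..1} (\<lambda>t. H (s0, t)) \<sigma> \<longrightarrow> flat {0..1} (\<lambda>t. H (s, t)) \<tau> \<longrightarrow>
    \<tau> 0 = T (H (s0, 0)) (H (s, 0)) (\<sigma> 0) \<longrightarrow> \<tau> 1 = T (H (s0, 1)) (H (s, 1)) (\<sigma> 1)"
proof -
  define F where "F = at s0 within {0..1}"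
  let ?C = "\<lambda>a b s. \<forall>\<sigma> \<tau>. flat {a..b} (\<lambda>t. H (s0, t)) \<sigma> \<longrightarrow> flat {a..b} (\<lambda>t. H (s, t)) \<tau> \<longrightarrow>
    \<tau> a = T (H (s0, a)) (H (s, a)) (\<sigma> a) \<longrightarrow> \<tau> b = T (H (s0, b)) (H (s, b)) (\<sigma> b)"
  \<comment> \<open>The admissible \<open>s\<close> may depend on the piece of the path; joining two
    pieces intersects two "eventually" conditions, which is again such a condition.\<close>
  let ?P = "\<lambda>a b. 0 \<le> a \<longrightarrow> a \<le> b \<longrightarrow> b \<le> 1 \<longrightarrow> (\<forall>\<^sub>F s in F. ?C a b s)"
  have "?P 0 1"
    using zero_le_one
  proof (rule Bolzano[where P = "?P"])
    fix u v w assume trans: "?P u v" "?P v w" "u \<le> v" "v \<le> w"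
    show "?P u w"
    proof (intro impI)
      assume *: "0 \<le> u" "u \<le> w" "w \<le> 1"
      have "\<forall>\<^sub>F s in F. ?C u v s" "\<forall>\<^sub>F s in F. ?C v w s"
        using trans * by auto
      then show "\<forall>\<^sub>F s in F. ?C u w s"
      proof eventually_elim
        case (elim s)
        have sub: "{u..v} \<subseteq> {u..w}" "{v..w} \<subseteq> {u..w}" using trans(3,4) by auto
        show ?case
        proof (intro allI impI)
          fix \<sigma> \<tau>
          assume \<sigma>: "flat {u..w} (\<lambda>t. H (s0, t)) \<sigma>" and \<tau>: "flat {u..w} (\<lambda>t. H (s, t)) \<tau>"
            and eq: "\<tau> u = T (H (s0, u)) (H (s, u)) (\<sigma> u)"
          have "\<tau> v = T (H (s0, v)) (H (s, v)) (\<sigma> v)"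
            using elim(1) flat_subset[OF \<sigma> sub(1)] flat_subset[OF \<tau> sub(1)] eq by simp
          then show "\<tau> w = T (H (s0, w)) (H (s, w)) (\<sigma> w)"
            using elim(2) flat_subset[OF \<sigma> sub(2)] flat_subset[OF \<tau> sub(2)] by simp
        qed
      qed
    qed
  next
    fix x :: real assume local: "0 \<le> x" "x \<le> 1"
    let ?c = "H (s0, x)"
    have x: "x \<in> {0..1}" using local by simp
    from homotopy_box[OF H s0 x] obtain e where c: "?c \<in> topspace B" and e: "e > 0"
      "\<And>s t. s \<in> {0..1} \<Longrightarrow> t \<in> {0..1} \<Longrightarrow> \<bar>s - s0\<bar> < e \<Longrightarrow> \<bar>t - x\<bar> < e \<Longrightarrow> H (s, t) \<in> min_nbhd B ?c"
      by blast
    \<comment> \<open>Closeness to the centre \<open>?c\<close> is not enough: comparing the two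
      lifts at \<open>u\<close> and at \<open>v\<close> by \<open>T\<close> needs
      \<open>H (s, t)\<close> in the smallest neighbourhood of \<open>H (s0, t)\<close>
      itself.\<close>
    have near: "\<forall>\<^sub>F s in F. H (s, t) \<in> min_nbhd B (H (s0, t))" if t: "t \<in> {0..1}" for t
    proof -
      from homotopy_box[OF H s0 t] obtain d where "d > 0"
        "\<And>s. s \<in> {0..1} \<Longrightarrow> \<bar>s - s0\<bar> < d \<Longrightarrow> H (s, t) \<in> min_nbhd B (H (s0, t))"
        using t by fastforce
      then show ?thesis unfolding F_def eventually_at dist_real_def by blast
    qed
    have "?P u v" if uv: "u \<le> x" "x \<le> v" "v - u < e" for u v
    proof (intro impI)
      assume *: "0 \<le> u" "u \<le> v" "v \<le> 1"
      have "\<forall>\<^sub>F s in F. s \<in> {0..1} \<and> \<bar>s - s0\<bar> < e"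
        using e(1) unfolding F_def eventually_at dist_real_def by blast
      moreover have "\<forall>\<^sub>F s in F. H (s, u) \<in> min_nbhd B (H (s0, u))"
        "\<forall>\<^sub>F s in F. H (s, v) \<in> min_nbhd B (H (s0, v))"
        using near * by auto
      ultimately show "\<forall>\<^sub>F s in F. ?C u v s"
      proof eventually_elim
        case (elim s)
        show ?case
        proof (intro allI impI)
          fix \<sigma> \<tau>
          assume \<sigma>: "flat {u..v} (\<lambda>t. H (s0, t)) \<sigma>" and \<tau>: "flat {u..v} (\<lambda>t. H (s, t)) \<tau>"
            and eq: "\<tau> u = T (H (s0, u)) (H (s, u)) (\<sigma> u)"
          have sub0: "(\<lambda>t. H (s0, t)) ` {u..v} \<subseteq> min_nbhd B ?c"
            using e uv * s0 by (intro image_subsetI e(2)) auto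
          have sub: "(\<lambda>t. H (s, t)) ` {u..v} \<subseteq> min_nbhd B ?c"
            using e uv * elim by (intro image_subsetI e(2)) auto
          have in_c: "H (s0, u) \<in> min_nbhd B ?c" "H (s0, v) \<in> min_nbhd B ?c"
            using sub0 *(2) by auto
          have "\<sigma> u \<in> Q (H (s0, u))" using flat_in(2)[OF \<sigma>, of u] *(2) by simp
          \<comment> \<open>Both lifts turn out to be transports of this one element
            \<open>r\<close> over \<open>?c\<close>, which settles their comparison at
            \<open>v\<close> by \<open>T_comp\<close>.\<close>
          then obtain r where r: "r \<in> Q ?c" "\<sigma> u = T ?c (H (s0, u)) r"
            using T_surj[OF c in_c(1)] by blast
          have "\<tau> u = T ?c (H (s, u)) r"
            using T_comp[OF c in_c(1) _ r(1)] elim r(2) eq by simp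
          then have "\<tau> v = T ?c (H (s, v)) r"
            using flat_local_unique[OF \<tau> *(2) c sub r(1)] by simp
          moreover have "\<sigma> v = T ?c (H (s0, v)) r"
            using flat_local_unique[OF \<sigma> *(2) c sub0 r(1)] r(2) by simp
          ultimately show "\<tau> v = T (H (s0, v)) (H (s, v)) (\<sigma> v)"
            using T_comp[OF c in_c(2) _ r(1)] elim by simp
        qed
      qed
    qed
    with e(1) show "\<exists>d>0. \<forall>u v. u \<le> x \<and> x \<le> v \<and> v - u < d \<longrightarrow> ?P u v"
      by (intro exI[of _ e]) simp
  qed
  then show ?thesis by (simp add: F_def)
qed

text \<open>Contract the loop by \<open>H\<close> and lift each \<open>H (s, -)\<close> from the
  same starting value. The ends of these paths stay at \<open>\<gamma> 0\<close>, so the comparison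
  maps in \<open>transport_homotopy\<close> are the identity and the end value \<open>L s 1\<close>
  is locally constant in \<open>s\<close>. At \<open>s = 1\<close> the path is constant, and so is
  its lift.\<close>

lemma flat_loop:
  assumes sc: "simply_connected_space B" and fl: "flat {0..1} \<gamma> \<sigma>" and loop: "\<gamma> 1 = \<gamma> 0"
  shows "\<sigma> 1 = \<sigma> 0"
proof -
  let ?x = "\<gamma> 0" and ?q = "\<sigma> 0"
  have x: "?x \<in> topspace B" and q: "?q \<in> Q ?x"
    using flat_in[OF fl, of 0] by auto
  have "\<gamma> \<in> loops_at B ?x"
    using flat_imp_continuous[OF fl] loop by (simp add: loops_at_def pathin_def)
  then have "loop_homotopic B ?x `` {\<gamma>} \<in> fundamental_group_carrier B ?x"
    by (simp add: fundamental_group_carrier_def quotientI)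
  then have "loop_homotopic B ?x `` {\<gamma>} = loop_homotopic B ?x `` {\<lambda>_. ?x}"
    using sc x by (simp add: simply_connected_space_def)
  moreover have "(\<lambda>_. ?x) \<in> loops_at B ?x"
    using x by (simp add: loops_at_def pathin_def)
  ultimately have "(\<gamma>, \<lambda>_. ?x) \<in> loop_homotopic B ?x"
    using eq_equiv_class[OF _ equiv_loop_homotopic] by metis
  then obtain H :: "real \<times> real \<Rightarrow> 'b" where H: "continuous_map (prod_topology (top_of_set {0..1}) (top_of_set {0..1})) B H"
    "\<And>t. H (0, t) = \<gamma> t" "\<And>t. H (1, t) = ?x"
    "\<forall>s\<in>{0..1}. H (s, 0) = ?x \<and> H (s, 1) = ?x"
    unfolding loop_homotopic_def homotopic_with_def mem_Collect_eq case_prod_conv by meson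
  have "\<exists>\<tau>. flat {0..1} (\<lambda>t. H (s, t)) \<tau> \<and> \<tau> 0 = ?q" if s: "s \<in> {0..1}" for s
  proof (rule flat_exists)
    show "continuous_map (top_of_set {0..1}) B (\<lambda>t. H (s, t))"
      using s by (intro continuous_map_compose[OF _ H(1), unfolded o_def] continuous_map_pairedI) auto
  qed (use H(4)[rule_format, OF s] q in auto)
  then obtain L where L: "\<And>s. s \<in> {0..1} \<Longrightarrow> flat {0..1} (\<lambda>t. H (s, t)) (L s) \<and> L s 0 = ?q"
    by metis
  have "\<forall>\<^sub>F s in at s0 within {0..1}. L s0 1 = L s 1" if s0: "s0 \<in> {0..1}" for s0
  proof -
    have "\<forall>\<^sub>F s in at s0 within {0..1}. s \<in> {0..1}"
      by (auto simp: eventually_at_topological)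
    with transport_homotopy[OF H(1) s0] show ?thesis
    proof eventually_elim
      case (elim s)
      have "L s 0 = T ?x ?x (L s0 0)"
        using L[OF s0] L[OF elim(2)] T_id[OF x q] by simp
      then have "L s 1 = T ?x ?x (L s0 1)"
        using elim(1) L[OF s0] L[OF elim(2)] H(4)[rule_format, OF s0] H(4)[rule_format, OF elim(2)] by metis
      moreover have "L s0 1 \<in> Q ?x"
        using flat_in(2)[of "{0..1}" "\<lambda>t. H (s0, t)" "L s0" 1] L[OF s0] H(4)[rule_format, OF s0] by simp
      ultimately show ?case using T_id[OF x] by simp
    qed
  qed
  then have "L 0 1 = L 1 1"
    using connected_local_const[of "{0..1::real}" 0 1 "\<lambda>s. L s 1"] by auto
  moreover have "L 0 1 = \<sigma> 1"
    using flat_unique[OF connected_Icc, of 0 1 \<gamma> "L 0" \<sigma> 0 1] L[of 0] fl H(2) by simp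
  moreover have "L 1 1 = ?q"
  proof -
    have "flat {0..1} (\<lambda>_. ?x) (\<lambda>_. ?q)"
      using x q in_min_nbhd T_id by (auto simp: flat_def)
    then show ?thesis
      using flat_unique[OF connected_Icc, of 0 1 "\<lambda>_. ?x" "L 1" "\<lambda>_. ?q" 0 1] L[of 1] H(3) by simp
  qed
  ultimately show ?thesis by simp
qed

section \<open>Path independence and the global section\<close>

lemma flat_path_concat:
  assumes fl: "flat {0..1} \<gamma> \<sigma>" "flat {0..1} \<delta> \<tau>" "\<delta> 0 = \<gamma> 1" "\<tau> 0 = \<sigma> 1"
  shows "flat {0..1} (\<lambda>t. if t \<le> 1/2 then \<gamma> (2 * t) else \<delta> (2 * t - 1))
    (\<lambda>t. if t \<le> 1/2 then \<sigma> (2 * t) else \<tau> (2 * t - 1))" (is "flat _ ?\<gamma> ?\<sigma>")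
proof (rule flat_join[of 0 "1/2"])
  have "flat {0..1/2} (\<gamma> \<circ> (\<lambda>t. 2 * t)) (\<sigma> \<circ> (\<lambda>t. 2 * t))"
    by (rule flat_reparam[OF fl(1)]) (auto intro!: continuous_intros)
  then show "flat {0..1/2} ?\<gamma> ?\<sigma>"
    by (rule flat_cong) auto
  have "flat {1/2..1} (\<delta> \<circ> (\<lambda>t. 2 * t - 1)) (\<tau> \<circ> (\<lambda>t. 2 * t - 1))"
    by (rule flat_reparam[OF fl(2)]) (auto intro!: continuous_intros)
  then show "flat {1/2..1} ?\<gamma> ?\<sigma>"
    by (rule flat_cong) (use fl(3,4) in \<open>auto simp: order_le_less mult.commute\<close>)
qed auto

text \<open>Run along \<open>\<gamma>\<close> and back along \<open>\<delta>\<close>: by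
  \<open>flat_loop\<close> the lift \<open>\<rho>\<close> of the way back ends at
  \<open>\<sigma> 0\<close>. Reversed, \<open>\<rho>\<close> is a lift of \<open>\<delta>\<close>
  with the same starting value as \<open>\<tau>\<close>, hence equal to it.\<close>

lemma flat_endpoint_unique:
  assumes sc: "simply_connected_space B"
    and fl: "flat {0..1} \<gamma> \<sigma>" "flat {0..1} \<delta> \<tau>" "\<delta> 0 = \<gamma> 0" "\<tau> 0 = \<sigma> 0" "\<delta> 1 = \<gamma> 1"
  shows "\<tau> 1 = \<sigma> 1"
proof -
  let ?r = "\<lambda>t::real. 1 - t"
  have "continuous_map (top_of_set {0..1}) B (\<delta> \<circ> ?r)"
    by (rule flat_imp_continuous[OF flat_reparam[OF fl(2)]]) (auto intro!: continuous_intros)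
  moreover have "\<sigma> 1 \<in> Q ((\<delta> \<circ> ?r) 0)"
    using flat_in[OF fl(1), of 1] fl(5) by simp
  ultimately obtain \<rho> where \<rho>: "flat {0..1} (\<delta> \<circ> ?r) \<rho>" "\<rho> 0 = \<sigma> 1"
    using flat_exists[OF zero_le_one] by blast
  have "\<rho> 1 = \<sigma> 0"
    using flat_loop[OF sc flat_path_concat[OF fl(1) \<rho>(1)]] \<rho>(2) fl(3,5) by simp
  have "flat {0..1} (\<delta> \<circ> ?r \<circ> ?r) (\<rho> \<circ> ?r)"
    by (rule flat_reparam[OF \<rho>(1)]) (auto intro!: continuous_intros)
  then have "flat {0..1} \<delta> (\<rho> \<circ> ?r)"
    by (simp add: o_def)
  then have "\<tau> 1 = (\<rho> \<circ> ?r) 1"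
    using flat_unique[OF connected_Icc fl(2), of _ 0 1] \<open>\<rho> 1 = \<sigma> 0\<close> fl(4) by simp
  then show ?thesis using \<rho>(2) by simp
qed

text \<open>In an Alexandroff space the jump from \<open>b\<close> to a point of its smallest neighbourhood is a
  continuous path.\<close>

lemma flat_step:
  assumes b: "b \<in> topspace B" "x \<in> min_nbhd B b" "q \<in> Q b"
  shows "flat {0..1} (\<lambda>t. if t \<le> 0 then b else x) (\<lambda>t. if t \<le> 0 then q else T b x q)"
proof -
  have x: "x \<in> topspace B" "T b x q \<in> Q x"
    using min_nbhd_topspace[OF b(1,2)] T_in[OF b] by auto
  have pos: "\<forall>\<^sub>F t' in at t within {0..1}. 0 < t'" if "0 < t" for t :: real
    using order_tendstoD(1)[OF tendsto_ident_at that] .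
  show ?thesis
    unfolding flat_def
  proof (intro ballI conjI)
    fix t :: real assume "t \<in> {0..1}"
    show "\<forall>\<^sub>F t' in at t within {0..1}.
        (if t' \<le> 0 then b else x) \<in> min_nbhd B (if t \<le> 0 then b else x) \<and>
        (if t' \<le> 0 then q else T b x q) =
          T (if t \<le> 0 then b else x) (if t' \<le> 0 then b else x) (if t \<le> 0 then q else T b x q)"
    proof (cases "t \<le> 0")
      case True
      then show ?thesis using b x T_id in_min_nbhd by simp
    next
      case False
      then have "\<forall>\<^sub>F t' in at t within {0..1}. 0 < t'" by (intro pos) simp
      then show ?thesis
        by eventually_elim (use False x T_id in simp)
    qed
  qed (use b x in auto)
qed

text \<open>The value at \<open>b\<close> is the end of a lift along an arbitrary path from
  \<open>b0\<close>. It is compatible with \<open>T\<close> because the path chosen for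
  \<open>b\<close>, followed by the jump to \<open>x\<close>, competes with the path chosen for
  \<open>x\<close>, and \<open>flat_endpoint_unique\<close> equates the two ends.\<close>

theorem global_section:
  assumes sc: "simply_connected_space B" and b0: "b0 \<in> topspace B" "q0 \<in> Q b0"
  obtains s where "\<And>b. b \<in> topspace B \<Longrightarrow> s b \<in> Q b"
    "\<And>b x. b \<in> topspace B \<Longrightarrow> x \<in> min_nbhd B b \<Longrightarrow> s x = T b x (s b)"
proof -
  have "\<exists>\<gamma> \<sigma>. flat {0..1} \<gamma> \<sigma> \<and> \<gamma> 0 = b0 \<and> \<sigma> 0 = q0 \<and> \<gamma> 1 = b" if b: "b \<in> topspace B" for b
  proof -
    obtain \<gamma> where "pathin B \<gamma>" "\<gamma> 0 = b0" "\<gamma> 1 = b"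
      using sc b b0 unfolding simply_connected_space_def path_connected_space_def by blast
    then show ?thesis
      using flat_exists[of 0 1 \<gamma> q0] b0(2) by (auto simp: pathin_def)
  qed
  then obtain \<gamma> \<sigma> where \<gamma>: "\<And>b. b \<in> topspace B \<Longrightarrow>
      flat {0..1} (\<gamma> b) (\<sigma> b) \<and> \<gamma> b 0 = b0 \<and> \<sigma> b 0 = q0 \<and> \<gamma> b 1 = b"
    by metis
  show thesis
  proof
    show in_Q: "\<sigma> b 1 \<in> Q b" if "b \<in> topspace B" for b
      using flat_in(2)[of "{0..1}" "\<gamma> b" "\<sigma> b" 1] \<gamma>[OF that] by simp
    show "\<sigma> x 1 = T b x (\<sigma> b 1)" if b: "b \<in> topspace B" "x \<in> min_nbhd B b" for b x
    proof -
      have x: "x \<in> topspace B" by (rule min_nbhd_topspace[OF b])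
      show ?thesis
        using flat_endpoint_unique[OF sc flat_path_concat[OF _ flat_step[OF b in_Q[OF b(1)]]], of "\<gamma> b" "\<sigma> b" "\<gamma> x" "\<sigma> x"]
          \<gamma>[OF b(1)] \<gamma>[OF x] by simp
    qed
  qed
qed

end

section \<open>Bundles over Alexandroff spaces\<close>

text \<open>Trivialisations are taken from the product to the total space, inverse to those in
  \<open>trivial_fiber_bundle\<close>.\<close>

definition bundle_trivialization ::
    "'e topology \<Rightarrow> 'b topology \<Rightarrow> 'f topology \<Rightarrow> ('e \<Rightarrow> 'b) \<Rightarrow> ('b \<times> 'f \<Rightarrow> 'e) \<Rightarrow> bool" where
  "bundle_trivialization E B F p k \<longleftrightarrow>
     homeomorphic_map (prod_topology B F) E k \<and>
     (\<forall>x\<in>topspace B. \<forall>v\<in>topspace F. p (k (x, v)) = x)"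

lemma trivial_fiber_bundle_iff:
  "trivial_fiber_bundle E B F p \<longleftrightarrow> (\<exists>k. bundle_trivialization E B F p k)"
proof
  assume "trivial_fiber_bundle E B F p"
  then obtain h k where h: "homeomorphic_maps E (prod_topology B F) h k"
    "\<And>e. e \<in> topspace E \<Longrightarrow> fst (h e) = p e"
    unfolding trivial_fiber_bundle_def homeomorphic_map_maps by blast
  have "p (k (x, v)) = x" if "x \<in> topspace B" "v \<in> topspace F" for x v
  proof -
    have xv: "(x, v) \<in> topspace (prod_topology B F)" using that by simp
    then have "k (x, v) \<in> topspace E" "h (k (x, v)) = (x, v)"
      using h(1) by (auto simp: homeomorphic_maps_def continuous_map_def)
    then show ?thesis using h(2) by fastforce
  qed
  then show "\<exists>k. bundle_trivialization E B F p k"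
    using h(1) by (auto simp: bundle_trivialization_def homeomorphic_maps_map)
next
  assume "\<exists>k. bundle_trivialization E B F p k"
  then obtain k h where k: "homeomorphic_maps (prod_topology B F) E k h"
    "\<And>x v. x \<in> topspace B \<Longrightarrow> v \<in> topspace F \<Longrightarrow> p (k (x, v)) = x"
    unfolding bundle_trivialization_def homeomorphic_map_maps by blast
  have "fst (h e) = p e" if "e \<in> topspace E" for e
  proof -
    have "h e \<in> topspace (prod_topology B F)" "k (h e) = e"
      using k(1) that by (auto simp: homeomorphic_maps_def continuous_map_def Pi_iff)
    then show ?thesis using k(2)[of "fst (h e)" "snd (h e)"] by auto
  qed
  then show "trivial_fiber_bundle E B F p"
    using k(1) by (auto simp: trivial_fiber_bundle_def homeomorphic_maps_map)
qed

lemma bundle_trivialization_restrict: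
  assumes k: "bundle_trivialization E B F p k" and U: "U \<subseteq> topspace B"
  shows "bundle_trivialization (subtopology E {e \<in> topspace E. p e \<in> U}) (subtopology B U) F p k"
proof -
  have hom: "homeomorphic_map (prod_topology B F) E k"
    and p: "\<And>x v. x \<in> topspace B \<Longrightarrow> v \<in> topspace F \<Longrightarrow> p (k (x, v)) = x"
    using k by (auto simp: bundle_trivialization_def)
  have img: "k ` (topspace B \<times> topspace F) = topspace E"
    using homeomorphic_imp_surjective_map[OF hom] by simp
  have "k ` (topspace (prod_topology B F) \<inter> U \<times> topspace F) = topspace E \<inter> {e \<in> topspace E. p e \<in> U}"
    (is "?L = ?R")
  proof
    show "?L \<subseteq> ?R" using img p by auto
    show "?R \<subseteq> ?L"
    proof
      fix e assume e: "e \<in> ?R"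
      then obtain x v where xv: "x \<in> topspace B" "v \<in> topspace F" "e = k (x, v)"
        using img by blast
      then have "x \<in> U" using e p by simp
      then show "e \<in> ?L" using xv by simp
    qed
  qed
  from homeomorphic_map_subtopologies[OF hom this] show ?thesis
    using U p by (auto simp: bundle_trivialization_def prod_topology_subtopology(1))
qed

lemma bundle_trivialization_subset:
  assumes k: "bundle_trivialization (subtopology E {e \<in> topspace E. p e \<in> V}) (subtopology B V) F p k"
    and A: "A \<subseteq> V" "A \<subseteq> topspace B"
  shows "bundle_trivialization (subtopology E {e \<in> topspace E. p e \<in> A}) (subtopology B A) F p k"
proof -
  have E: "subtopology (subtopology E {e \<in> topspace E. p e \<in> V})
      {e \<in> topspace (subtopology E {e \<in> topspace E. p e \<in> V}). p e \<in> A} =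
    subtopology E {e \<in> topspace E. p e \<in> A}"
    unfolding subtopology_subtopology by (rule arg_cong2[where f = subtopology]) (use A in auto)
  have B: "subtopology (subtopology B V) A = subtopology B A"
    using A by (simp add: subtopology_subtopology inf.absorb2)
  have "A \<subseteq> topspace (subtopology B V)" using A by auto
  from bundle_trivialization_restrict[OF k this] show ?thesis
    by (simp only: E B)
qed

section \<open>Trivialisations over smallest neighbourhoods\<close>

locale Alexandroff_fiber_bundle =
  fixes E :: "'e topology" and B :: "'b topology" and F :: "'f topology" and p :: "'e \<Rightarrow> 'b"
  assumes alex: "Alexandroff_space B" and fib: "fiber_bundle E B F p"
begin

abbreviation "U \<equiv> min_nbhd B"

definition fibre :: "'b \<Rightarrow> 'e topology" where
  "fibre x = subtopology E {e \<in> topspace E. p e = x}"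

definition over_U :: "'b \<Rightarrow> 'e topology" where
  "over_U b = subtopology E {e \<in> topspace E. p e \<in> U b}"

definition triv :: "'b \<Rightarrow> ('b \<times> 'f \<Rightarrow> 'e) \<Rightarrow> bool" where
  "triv b k \<longleftrightarrow> bundle_trivialization (over_U b) (subtopology B (U b)) F p k"

definition frames :: "'b \<Rightarrow> ('f \<Rightarrow> 'e) set" where
  "frames x = {f. homeomorphic_map F (fibre x) f}"

definition indist :: "'e \<Rightarrow> 'e \<Rightarrow> bool" where
  "indist e e' \<longleftrightarrow> (\<forall>W. openin E W \<longrightarrow> (e \<in> W \<longleftrightarrow> e' \<in> W))"

text \<open>Besides indistinguishable values, this identifies functions that differ only outside
  \<open>topspace F\<close>, where a frame is arbitrary.\<close>

definition frame_rel :: "'b \<Rightarrow> (('f \<Rightarrow> 'e) \<times> ('f \<Rightarrow> 'e)) set" where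
  "frame_rel x = {(f, g). f \<in> frames x \<and> g \<in> frames x \<and> (\<forall>v\<in>topspace F. indist (f v) (g v))}"

definition frame_class :: "'b \<Rightarrow> ('b \<times> 'f \<Rightarrow> 'e) \<Rightarrow> ('f \<Rightarrow> 'e) set" where
  "frame_class x k = frame_rel x `` {\<lambda>v. k (x, v)}"

text \<open>A class over \<open>b\<close> is extended over \<open>U b\<close> by some trivialisation
  and then restricted to \<open>x\<close>; by \<open>frame_class_cong_iff\<close> the choice of
  trivialisation does not affect the result.\<close>

definition transport :: "'b \<Rightarrow> 'b \<Rightarrow> ('f \<Rightarrow> 'e) set \<Rightarrow> ('f \<Rightarrow> 'e) set" where
  "transport b x C = frame_class x (SOME k. triv b k \<and> frame_class b k = C)"

lemma continuous_p: "continuous_map E B p"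
  using fib by (simp add: fiber_bundle_def)

lemma p_in: "e \<in> topspace E \<Longrightarrow> p e \<in> topspace B"
  using continuous_p by (auto simp: continuous_map_def)

lemma openin_U: "b \<in> topspace B \<Longrightarrow> openin B (U b)"
  using openin_min_nbhd[OF alex] .

lemma U_topspace: "b \<in> topspace B \<Longrightarrow> U b \<subseteq> topspace B"
  using openin_U openin_subset by blast

lemma U_mono: "b \<in> topspace B \<Longrightarrow> x \<in> U b \<Longrightarrow> U x \<subseteq> U b"
  using min_nbhd_mono[OF alex] .

lemma openin_preimage_U: "b \<in> topspace B \<Longrightarrow> openin E {e \<in> topspace E. p e \<in> U b}"
  using openin_continuous_map_preimage[OF continuous_p openin_U] .

lemma triv_exists:
  assumes b: "b \<in> topspace B"
  obtains k where "triv b k"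
proof -
  obtain V k where V: "openin B V" "b \<in> V" and
    k: "bundle_trivialization (subtopology E {e \<in> topspace E. p e \<in> V}) (subtopology B V) F p k"
    using fib b unfolding fiber_bundle_def trivial_fiber_bundle_iff by blast
  have sub: "U b \<subseteq> V" using min_nbhd_subset[OF V] .
  have "triv b k"
    unfolding triv_def over_U_def by (rule bundle_trivialization_subset[OF k sub U_topspace[OF b]])
  then show thesis by (rule that)
qed

text \<open>With this, a single \<open>k\<close> over \<open>U b\<close> computes transport from
  \<open>b\<close> and also transport from each \<open>x\<close> in \<open>U b\<close>, which yields
  the composition law.\<close>

lemma triv_mono:
  assumes b: "b \<in> topspace B" and x: "x \<in> U b" and k: "triv b k"
  shows "triv x k"
proof -
  have "U x \<subseteq> U b" "U x \<subseteq> topspace B" using U_mono[OF b x] U_topspace[OF b] by auto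
  then show ?thesis
    using k unfolding triv_def over_U_def by (rule bundle_trivialization_subset[rotated])
qed

context
  fixes b k
  assumes b: "b \<in> topspace B" and k: "triv b k"
begin

lemma triv_homeomorphic: "homeomorphic_map (prod_topology (subtopology B (U b)) F) (over_U b) k"
  using k by (simp add: triv_def bundle_trivialization_def)

lemma triv_p: "x \<in> U b \<Longrightarrow> v \<in> topspace F \<Longrightarrow> p (k (x, v)) = x"
  using k U_topspace[OF b] by (auto simp: triv_def bundle_trivialization_def)

lemma triv_in:
  assumes "x \<in> U b" "v \<in> topspace F" shows "k (x, v) \<in> topspace E"
proof -
  have "(x, v) \<in> topspace (prod_topology (subtopology B (U b)) F)"
    using assms U_topspace[OF b] by auto
  then have "k (x, v) \<in> topspace (over_U b)"
    using homeomorphic_imp_surjective_map[OF triv_homeomorphic] by blast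
  then show ?thesis by (simp add: over_U_def)
qed

lemma triv_inj:
  assumes "x \<in> U b" "v \<in> topspace F" "w \<in> topspace F" "k (x, v) = k (x, w)"
  shows "v = w"
proof -
  have "inj_on k (topspace (prod_topology (subtopology B (U b)) F))"
    using triv_homeomorphic by (rule homeomorphic_imp_injective_map)
  then have "(x, v) = (x, w)"
    by (rule inj_onD) (use assms U_topspace[OF b] in auto)
  then show ?thesis by simp
qed

lemma triv_surj:
  assumes "e \<in> topspace E" "p e \<in> U b"
  obtains v where "v \<in> topspace F" "e = k (p e, v)"
proof -
  have "e \<in> k ` topspace (prod_topology (subtopology B (U b)) F)"
    using assms homeomorphic_imp_surjective_map[OF triv_homeomorphic] by (simp add: over_U_def)
  then obtain x v where "x \<in> U b" "v \<in> topspace F" "e = k (x, v)" by auto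
  then show thesis using that triv_p by metis
qed

lemma triv_open_image:
  assumes "openin F V" shows "openin E (k ` (U b \<times> V))"
proof -
  have "openin (prod_topology (subtopology B (U b)) F) (U b \<times> V)"
    using assms openin_U[OF b] by (simp add: openin_prod_Times_iff openin_open_subtopology)
  then have "openin (over_U b) (k ` (U b \<times> V))"
    using homeomorphic_imp_open_map[OF triv_homeomorphic] by (simp add: open_map_def)
  then show ?thesis
    by (simp add: over_U_def openin_open_subtopology[OF openin_preimage_U[OF b]])
qed

lemma triv_image_iff:
  assumes "V \<subseteq> topspace F" "x \<in> U b" "v \<in> topspace F"
  shows "k (x, v) \<in> k ` (U b \<times> V) \<longleftrightarrow> v \<in> V"
proof
  assume "k (x, v) \<in> k ` (U b \<times> V)"
  then obtain y w where yw: "y \<in> U b" "w \<in> V" "k (x, v) = k (y, w)" by auto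
  then have "x = y" using triv_p[of x v] triv_p[of y w] assms by auto
  then show "v \<in> V" using triv_inj[of x v w] yw assms by auto
qed (use assms in auto)

lemma triv_continuous: "continuous_map (prod_topology (subtopology B (U b)) F) E k"
  using homeomorphic_imp_continuous_map[OF triv_homeomorphic]
  by (simp add: over_U_def continuous_map_in_subtopology)

text \<open>An open box around \<open>(b, v)\<close> has a first factor that is a neighbourhood of
  \<open>b\<close>, hence contains all of \<open>U b\<close>. So membership in an open set passes
  from the fibre over \<open>b\<close> to every fibre over \<open>U b\<close>, though not
  back.\<close>

lemma triv_spread:
  assumes W: "openin E W" and v: "v \<in> topspace F" "k (b, v) \<in> W" and x: "x \<in> U b"
  shows "k (x, v) \<in> W"
proof -
  let ?S = "{z \<in> topspace (prod_topology (subtopology B (U b)) F). k z \<in> W}"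
  have "openin (prod_topology (subtopology B (U b)) F) ?S"
    using openin_continuous_map_preimage[OF triv_continuous W] .
  moreover have "(b, v) \<in> ?S" using v b by auto
  ultimately obtain A V where A: "openin (subtopology B (U b)) A" "b \<in> A" "v \<in> V" "A \<times> V \<subseteq> ?S"
    unfolding openin_prod_topology_alt by blast
  have "openin B A" using A(1) by (simp add: openin_open_subtopology[OF openin_U[OF b]])
  then have "x \<in> A" using min_nbhd_subset[OF _ A(2)] x by blast
  then show ?thesis using A by auto
qed

lemma triv_frame:
  assumes x: "x \<in> U b"
  shows "(\<lambda>v. k (x, v)) \<in> frames x"
proof -
  have xB: "x \<in> topspace B" using U_topspace[OF b] x by auto
  have "homeomorphic_map F (prod_topology (subtopology B {x}) F) (Pair x)"
    unfolding homeomorphic_map_maps homeomorphic_maps_def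
    by (rule exI[of _ snd])
      (use x xB in \<open>auto intro!: continuous_map_pairedI continuous_map_snd simp: continuous_map_in_subtopology\<close>)
  moreover have "bundle_trivialization (subtopology E {e \<in> topspace E. p e \<in> {x}}) (subtopology B {x}) F p k"
    by (rule bundle_trivialization_subset[OF k[unfolded triv_def over_U_def]]) (use x xB in auto)
  then have "homeomorphic_map (prod_topology (subtopology B {x}) F) (fibre x) k"
    by (simp add: bundle_trivialization_def fibre_def)
  ultimately have "homeomorphic_map F (fibre x) (k \<circ> Pair x)"
    by (rule homeomorphic_map_compose)
  then show ?thesis by (simp add: frames_def o_def)
qed

text \<open>Precompose \<open>k\<close> with the automorphism \<open>g \<circ> f\<close> of
  \<open>F\<close>, the same over every point of \<open>U b\<close>, where \<open>g\<close> inverts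
  \<open>k\<close> on the fibre over \<open>x\<close>. The point \<open>x\<close> need not be
  \<open>b\<close>; this is the source of surjectivity of \<open>transport\<close>.\<close>

lemma triv_reparam:
  assumes x: "x \<in> U b" and f: "f \<in> frames x"
  obtains k' where "triv b k'" "\<And>v. v \<in> topspace F \<Longrightarrow> k' (x, v) = f v"
proof -
  obtain g where g: "homeomorphic_maps F (fibre x) (\<lambda>v. k (x, v)) g"
    using triv_frame[OF x] by (auto simp: frames_def homeomorphic_map_maps)
  have f': "homeomorphic_map F (fibre x) f" using f by (simp add: frames_def)
  have "homeomorphic_map F F (g \<circ> f)"
    using g by (intro homeomorphic_map_compose[OF f']) (simp add: homeomorphic_maps_map)
  then obtain h where "homeomorphic_maps F F (g \<circ> f) h"
    by (auto simp: homeomorphic_map_maps)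
  then have "homeomorphic_maps (prod_topology (subtopology B (U b)) F) (prod_topology (subtopology B (U b)) F)
      (\<lambda>(y, v). (id y, (g \<circ> f) v)) (\<lambda>(y, v). (id y, h v))"
    unfolding homeomorphic_maps_prod by (auto simp: homeomorphic_maps_def o_def continuous_map_id[unfolded id_def])
  then have hom: "homeomorphic_map (prod_topology (subtopology B (U b)) F) (prod_topology (subtopology B (U b)) F)
      (\<lambda>(y, v). (id y, (g \<circ> f) v))"
    by (simp add: homeomorphic_maps_map)
  have gf: "g (f v) \<in> topspace F" if "v \<in> topspace F" for v
    using homeomorphic_imp_surjective_map[OF \<open>homeomorphic_map F F (g \<circ> f)\<close>] that by auto
  show thesis
  proof
    show "triv b (k \<circ> (\<lambda>(y, v). (id y, (g \<circ> f) v)))"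
      unfolding triv_def bundle_trivialization_def
      using homeomorphic_map_compose[OF hom triv_homeomorphic] triv_p gf by auto
    fix v assume v: "v \<in> topspace F"
    have "f v \<in> topspace (fibre x)"
      using homeomorphic_imp_surjective_map[OF f'] v by auto
    then show "(k \<circ> (\<lambda>(y, v). (id y, (g \<circ> f) v))) (x, v) = f v"
      using g by (simp add: homeomorphic_maps_def)
  qed
qed

end

section \<open>The local system of frame classes\<close>

lemma indist_sym: "indist e e' \<Longrightarrow> indist e' e"
  by (simp add: indist_def)

lemma equiv_frame_rel: "equiv (frames x) (frame_rel x)"
  by (rule equivI) (auto simp: frame_rel_def refl_on_def sym_def trans_def indist_def)

lemma frame_class_eq_iff:
  assumes b: "b \<in> topspace B" and k: "triv b k" "triv b k'" and x: "x \<in> U b"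
  shows "frame_class x k = frame_class x k' \<longleftrightarrow> (\<forall>v\<in>topspace F. indist (k (x, v)) (k' (x, v)))"
  unfolding frame_class_def
    eq_equiv_class_iff[OF equiv_frame_rel triv_frame[OF b k(1) x] triv_frame[OF b k(2) x]]
  by (simp add: frame_rel_def triv_frame[OF b k(1) x] triv_frame[OF b k(2) x])

text \<open>Let \<open>V\<close> be the trace of \<open>W\<close> on the fibre over
  \<open>x\<close>, read through \<open>k\<close>. The image of \<open>U b \<times> V\<close> under
  \<open>k\<close> is open and contains \<open>k (b, v)\<close>, hence \<open>k' (b, v)\<close>,
  hence by spreading along \<open>k'\<close> also \<open>k' (x, v)\<close>. Over \<open>x\<close>
  this image lies inside \<open>W\<close>.\<close>

lemma indist_down:
  assumes b: "b \<in> topspace B" and k: "triv b k" "triv b k'" and x: "x \<in> U b"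
    and ind: "\<And>v. v \<in> topspace F \<Longrightarrow> indist (k (b, v)) (k' (b, v))"
    and W: "openin E W" "v \<in> topspace F" "k (x, v) \<in> W"
  shows "k' (x, v) \<in> W"
proof -
  let ?V = "{w \<in> topspace F. k (x, w) \<in> W}"
  have "continuous_map F E (\<lambda>v. k (x, v))"
    using triv_frame[OF b k(1) x]
    by (auto simp: frames_def fibre_def continuous_map_in_subtopology dest: homeomorphic_imp_continuous_map)
  then have V: "openin F ?V"
    using openin_continuous_map_preimage W(1) by blast
  note W' = triv_open_image[OF b k(1) V]
  have "k (b, v) \<in> k ` (U b \<times> ?V)" using W by auto
  then have "k' (b, v) \<in> k ` (U b \<times> ?V)"
    using ind[OF W(2)] W' by (auto simp: indist_def)
  then have "k' (x, v) \<in> k ` (U b \<times> ?V)"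
    by (rule triv_spread[OF b k(2) W' W(2) _ x])
  then obtain y w where yw: "y \<in> U b" "w \<in> ?V" "k' (x, v) = k (y, w)" by auto
  then have "y = x" using triv_p[OF b k(1), of y w] triv_p[OF b k(2) x W(2)] by auto
  then show ?thesis using yw by auto
qed

text \<open>Spreading goes only from \<open>b\<close> to \<open>x\<close>, so the way back uses the
  product structure. With \<open>V\<close> now read over \<open>b\<close>, the image of
  \<open>U b \<times> V\<close> under \<open>k\<close> contains \<open>k' (b, v)\<close>, then
  \<open>k' (x, v)\<close>, then by assumption \<open>k (x, v)\<close>. Belonging to this image
  depends only on the second coordinate, so \<open>v \<in> V\<close>.\<close>

lemma indist_up:
  assumes b: "b \<in> topspace B" and k: "triv b k" "triv b k'" and x: "x \<in> U b"
    and ind: "\<And>v. v \<in> topspace F \<Longrightarrow> indist (k (x, v)) (k' (x, v))"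
    and W: "openin E W" "v \<in> topspace F" "k' (b, v) \<in> W"
  shows "k (b, v) \<in> W"
proof -
  let ?V = "{w \<in> topspace F. k (b, w) \<in> W}"
  have "continuous_map F E (\<lambda>v. k (b, v))"
    using triv_frame[OF b k(1) in_min_nbhd]
    by (auto simp: frames_def fibre_def continuous_map_in_subtopology dest: homeomorphic_imp_continuous_map)
  then have V: "openin F ?V"
    using openin_continuous_map_preimage W(1) by blast
  have Vs: "?V \<subseteq> topspace F" by auto
  note W' = triv_open_image[OF b k(1) V]
  obtain w where w: "w \<in> topspace F" "k' (b, v) = k (p (k' (b, v)), w)"
    using triv_surj[OF b k(1) triv_in[OF b k(2) in_min_nbhd W(2)]] triv_p[OF b k(2) in_min_nbhd W(2)]
    by auto
  then have "k' (b, v) \<in> k ` (U b \<times> ?V)"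
    using triv_p[OF b k(2) in_min_nbhd W(2)] W(3) by auto
  then have "k' (x, v) \<in> k ` (U b \<times> ?V)"
    by (rule triv_spread[OF b k(2) W' W(2) _ x])
  then have "k (x, v) \<in> k ` (U b \<times> ?V)"
    using ind[OF W(2)] W' by (auto simp: indist_def)
  then have "v \<in> ?V" using triv_image_iff[OF b k(1) Vs x W(2)] by simp
  then show ?thesis by simp
qed

text \<open>From right to left this makes \<open>transport\<close> independent of the chosen
  trivialisation; from left to right it makes \<open>transport\<close> injective.\<close>

lemma frame_class_cong_iff:
  assumes b: "b \<in> topspace B" and k: "triv b k" "triv b k'" and x: "x \<in> U b"
  shows "frame_class x k = frame_class x k' \<longleftrightarrow> frame_class b k = frame_class b k'"
  unfolding frame_class_eq_iff[OF b k x] frame_class_eq_iff[OF b k in_min_nbhd]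
proof
  assume *: "\<forall>v\<in>topspace F. indist (k (x, v)) (k' (x, v))"
  then show "\<forall>v\<in>topspace F. indist (k (b, v)) (k' (b, v))"
    using indist_up[OF b k x] indist_up[OF b k(2,1) x] indist_sym unfolding indist_def[of "k (b, _)"]
    by metis
next
  assume *: "\<forall>v\<in>topspace F. indist (k (b, v)) (k' (b, v))"
  then show "\<forall>v\<in>topspace F. indist (k (x, v)) (k' (x, v))"
    using indist_down[OF b k x] indist_down[OF b k(2,1) x] indist_sym unfolding indist_def[of "k (x, _)"]
    by metis
qed

text \<open>For \<open>x = b\<close> it puts a class into the form on which
  \<open>transport_frame_class\<close> computes; for other \<open>x\<close> it gives surjectivity of
  \<open>transport\<close>.\<close>

lemma triv_representative:
  assumes b: "b \<in> topspace B" and x: "x \<in> U b" and C: "C \<in> frames x // frame_rel x"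
  obtains k where "triv b k" "C = frame_class x k"
proof -
  obtain f where f: "f \<in> frames x" "C = frame_rel x `` {f}"
    using C by (rule quotientE)
  obtain k0 where "triv b k0" using triv_exists[OF b] .
  then obtain k where k: "triv b k" "\<And>v. v \<in> topspace F \<Longrightarrow> k (x, v) = f v"
    using triv_reparam[OF b _ x f(1)] by metis
  have "(f, \<lambda>v. k (x, v)) \<in> frame_rel x"
    using f(1) triv_frame[OF b k(1) x] k(2) by (simp add: frame_rel_def indist_def)
  then have "C = frame_class x k"
    unfolding f(2) frame_class_def by (rule equiv_class_eq[OF equiv_frame_rel])
  then show thesis using that k(1) by blast
qed

lemma frame_class_in:
  assumes "b \<in> topspace B" "triv b k" "x \<in> U b"
  shows "frame_class x k \<in> frames x // frame_rel x"
  unfolding frame_class_def by (rule quotientI[OF triv_frame[OF assms]])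

lemma transport_frame_class:
  assumes b: "b \<in> topspace B" and k: "triv b k" and x: "x \<in> U b"
  shows "transport b x (frame_class b k) = frame_class x k"
proof -
  define k' where "k' = (SOME k'. triv b k' \<and> frame_class b k' = frame_class b k)"
  have "triv b k' \<and> frame_class b k' = frame_class b k"
    unfolding k'_def by (rule someI[of _ k]) (simp add: k)
  then show ?thesis
    using frame_class_cong_iff[OF b _ k x, of k'] by (simp add: transport_def flip: k'_def)
qed

lemma local_system_frames: "local_system B (\<lambda>x. frames x // frame_rel x) transport"
proof
  show "Alexandroff_space B" by (rule alex)
next
  fix b x assume b: "b \<in> topspace B" and x: "x \<in> U b"
  show "bij_betw (transport b x) (frames b // frame_rel b) (frames x // frame_rel x)"
  proof (rule bij_betw_imageI)
    show "inj_on (transport b x) (frames b // frame_rel b)"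
    proof (rule inj_onI)
      fix C C' assume C: "C \<in> frames b // frame_rel b" "C' \<in> frames b // frame_rel b"
        and eq: "transport b x C = transport b x C'"
      obtain k where k: "triv b k" "C = frame_class b k"
        using triv_representative[OF b in_min_nbhd C(1)] .
      obtain k' where k': "triv b k'" "C' = frame_class b k'"
        using triv_representative[OF b in_min_nbhd C(2)] .
      show "C = C'"
        using eq frame_class_cong_iff[OF b k(1) k'(1) x]
          transport_frame_class[OF b k(1) x] transport_frame_class[OF b k'(1) x]
        by (simp add: k(2) k'(2))
    qed
    show "transport b x ` (frames b // frame_rel b) = frames x // frame_rel x"
    proof (intro subset_antisym subsetI)
      fix D assume "D \<in> transport b x ` (frames b // frame_rel b)"
      then obtain C where C: "C \<in> frames b // frame_rel b" "D = transport b x C" by blast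
      obtain k where "triv b k" "C = frame_class b k"
        using triv_representative[OF b in_min_nbhd C(1)] .
      then show "D \<in> frames x // frame_rel x"
        using transport_frame_class[OF b _ x] frame_class_in[OF b _ x] C(2) by simp
    next
      fix D assume D: "D \<in> frames x // frame_rel x"
      obtain k where k: "triv b k" "D = frame_class x k"
        using triv_representative[OF b x D] .
      then have "D = transport b x (frame_class b k)"
        using transport_frame_class[OF b k(1) x] by simp
      then show "D \<in> transport b x ` (frames b // frame_rel b)"
        using frame_class_in[OF b k(1) in_min_nbhd] by blast
    qed
  qed
next
  fix b C assume b: "b \<in> topspace B" and C: "C \<in> frames b // frame_rel b"
  obtain k where "triv b k" "C = frame_class b k"
    using triv_representative[OF b in_min_nbhd C] .
  then show "transport b b C = C"
    using transport_frame_class[OF b _ in_min_nbhd] by simp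
next
  fix b x y C assume b: "b \<in> topspace B" and x: "x \<in> U b" and y: "y \<in> U x"
    and C: "C \<in> frames b // frame_rel b"
  obtain k where k: "triv b k" "C = frame_class b k"
    using triv_representative[OF b in_min_nbhd C] .
  have xB: "x \<in> topspace B" and yb: "y \<in> U b"
    using U_topspace[OF b] U_mono[OF b x] x y by auto
  \<comment> \<open>The same \<open>k\<close> computes all three transports; over \<open>U x\<close>
    it is a trivialisation by \<open>triv_mono\<close>.\<close>
  show "transport x y (transport b x C) = transport b y C"
    using transport_frame_class[OF b k(1) x] transport_frame_class[OF b k(1) yb]
      transport_frame_class[OF xB triv_mono[OF b x k(1)] y] by (simp add: k(2))
qed

section \<open>Gluing frames to a global trivialisation\<close>

text \<open>Bijectivity of \<open>h\<close> is a matter of single fibres, since each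
  \<open>f x\<close> maps \<open>F\<close> onto the fibre over \<open>x\<close>. Continuity and
  openness are tested on open sets of \<open>E\<close>, which cannot tell \<open>h\<close> from the
  trivialisation \<open>k\<close> over \<open>U b\<close>.\<close>

theorem trivial_if_compatible_frames:
  assumes f: "\<And>x. x \<in> topspace B \<Longrightarrow> f x \<in> frames x"
    and compat: "\<And>b. b \<in> topspace B \<Longrightarrow>
      \<exists>k. triv b k \<and> (\<forall>x\<in>U b. \<forall>v\<in>topspace F. indist (k (x, v)) (f x v))"
  shows "trivial_fiber_bundle E B F p"
proof -
  define h where "h = (\<lambda>(x, v). f x v)"
  have hf: "homeomorphic_map F (fibre x) (f x)" if "x \<in> topspace B" for x
    using f[OF that] by (simp add: frames_def)
  have f_img: "f x ` topspace F = {e \<in> topspace E. p e = x}" if "x \<in> topspace B" for x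
    using homeomorphic_imp_surjective_map[OF hf[OF that]] by (auto simp: fibre_def)
  have f_in: "f x v \<in> topspace E" "p (f x v) = x" if "x \<in> topspace B" "v \<in> topspace F" for x v
    using f_img[OF that(1)] that(2) by auto
  have "homeomorphic_map (prod_topology B F) E h"
  proof (rule bijective_open_imp_homeomorphic_map)
    show "continuous_map (prod_topology B F) E h"
      unfolding continuous_map_def
    proof (intro conjI allI impI)
      show "h \<in> topspace (prod_topology B F) \<rightarrow> topspace E"
        using f_in by (auto simp: h_def)
      fix W assume W: "openin E W"
      show "openin (prod_topology B F) {z \<in> topspace (prod_topology B F). h z \<in> W}"
        unfolding openin_prod_topology_alt
      proof (intro allI impI)
        fix b v assume "(b, v) \<in> {z \<in> topspace (prod_topology B F). h z \<in> W}"
        then have b: "b \<in> topspace B" and v: "v \<in> topspace F" and fW: "f b v \<in> W"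
          by (auto simp: h_def)
        obtain k where k: "triv b k"
          and ind: "\<And>x v. x \<in> U b \<Longrightarrow> v \<in> topspace F \<Longrightarrow> indist (k (x, v)) (f x v)"
          using compat[OF b] by blast
        let ?V = "{w \<in> topspace F. f b w \<in> W}"
        have "continuous_map F E (f b)"
          using homeomorphic_imp_continuous_map[OF hf[OF b]]
          by (simp add: fibre_def continuous_map_in_subtopology)
        then have V: "openin F ?V"
          using openin_continuous_map_preimage W by blast
        \<comment> \<open>Replace \<open>f\<close> by \<open>k\<close> over \<open>b\<close>, spread
          along \<open>k\<close> to \<open>x\<close>, and return to \<open>f\<close> over
          \<open>x\<close>.\<close>
        have "f x w \<in> W" if "x \<in> U b" "w \<in> ?V" for x w
        proof -
          have "k (b, w) \<in> W" using ind[OF in_min_nbhd, of w] that W by (auto simp: indist_def)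
          then have "k (x, w) \<in> W" using triv_spread[OF b k W] that by auto
          then show ?thesis using ind[OF that(1), of w] that W by (auto simp: indist_def)
        qed
        then have "U b \<times> ?V \<subseteq> {z \<in> topspace (prod_topology B F). h z \<in> W}"
          using U_topspace[OF b] by (auto simp: h_def)
        then show "\<exists>A V. openin B A \<and> openin F V \<and> b \<in> A \<and> v \<in> V \<and>
            A \<times> V \<subseteq> {z \<in> topspace (prod_topology B F). h z \<in> W}"
          using openin_U[OF b] V v fW by (intro exI[of _ "U b"] exI[of _ ?V]) simp
      qed
    qed
    show "open_map (prod_topology B F) E h"
      unfolding open_map_def
    proof (intro allI impI)
      fix S assume S: "openin (prod_topology B F) S"
      show "openin E (h ` S)"
      proof (subst openin_subopen, intro ballI)
        fix e assume "e \<in> h ` S"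
        then obtain b v where bv: "(b, v) \<in> S" "e = f b v" by (auto simp: h_def)
        then obtain A V where A: "openin B A" "openin F V" "b \<in> A" "v \<in> V" "A \<times> V \<subseteq> S"
          using S unfolding openin_prod_topology_alt by metis
        have b: "b \<in> topspace B" and v: "v \<in> topspace F" and Vs: "V \<subseteq> topspace F"
          using A openin_subset by blast+
        obtain k where k: "triv b k"
          and ind: "\<And>x v. x \<in> U b \<Longrightarrow> v \<in> topspace F \<Longrightarrow> indist (k (x, v)) (f x v)"
          using compat[OF b] by blast
        let ?W = "k ` (U b \<times> V)"
        have W: "openin E ?W" by (rule triv_open_image[OF b k A(2)])
        have "k (b, v) \<in> ?W" using A(4) by auto
        then have "e \<in> ?W" using ind[OF in_min_nbhd v] W bv(2) by (auto simp: indist_def)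
        moreover have "?W \<subseteq> h ` S"
        proof
          fix e' assume e': "e' \<in> ?W"
          then obtain x w where xw: "x \<in> U b" "w \<in> V" "e' = k (x, w)" by auto
          have x: "x \<in> topspace B" using U_topspace[OF b] xw(1) by auto
          have "e' \<in> topspace E" "p e' = x"
            using triv_in[OF b k xw(1)] triv_p[OF b k xw(1)] xw Vs by auto
          \<comment> \<open>\<open>u\<close> may differ from \<open>w\<close>. But
            \<open>k (x, u)\<close> is indistinguishable from \<open>e'\<close>, so it lies in the
            open set \<open>?W\<close>, and this forces \<open>u \<in> V\<close>.\<close>
          then obtain u where u: "u \<in> topspace F" "e' = f x u"
            using f_img[OF x] by (metis (mono_tags, lifting) imageE mem_Collect_eq)
          have "k (x, u) \<in> ?W"
            using ind[OF xw(1) u(1)] e' u(2) W by (auto simp: indist_def)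
          then have "u \<in> V" using triv_image_iff[OF b k Vs xw(1) u(1)] by simp
          moreover have "x \<in> A" using min_nbhd_subset[OF A(1,3)] xw(1) by auto
          ultimately have "(x, u) \<in> S" using A(5) by auto
          then show "e' \<in> h ` S" using u(2) by (force simp: h_def)
        qed
        ultimately show "\<exists>T. openin E T \<and> e \<in> T \<and> T \<subseteq> h ` S" using W by blast
      qed
    qed
    show "h ` topspace (prod_topology B F) = topspace E"
    proof
      show "h ` topspace (prod_topology B F) \<subseteq> topspace E"
        using f_in by (auto simp: h_def)
      show "topspace E \<subseteq> h ` topspace (prod_topology B F)"
      proof
        fix e assume e: "e \<in> topspace E"
        then have "e \<in> f (p e) ` topspace F" using f_img[OF p_in[OF e]] by simp
        then show "e \<in> h ` topspace (prod_topology B F)"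
          using p_in[OF e] by (force simp: h_def)
      qed
    qed
    show "inj_on h (topspace (prod_topology B F))"
    proof (rule inj_onI)
      fix z z' assume z: "z \<in> topspace (prod_topology B F)" "z' \<in> topspace (prod_topology B F)"
        and eq: "h z = h z'"
      obtain x v x' v' where xv: "z = (x, v)" "z' = (x', v')" by fastforce
      have "x = x'" using eq f_in(2)[of x v] f_in(2)[of x' v'] z xv by (auto simp: h_def)
      moreover have "inj_on (f x) (topspace F)"
        using homeomorphic_imp_injective_map[OF hf] z xv by auto
      ultimately show "z = z'" using eq z xv by (auto simp: h_def inj_on_def)
    qed
  qed
  then show ?thesis
    using f_in(2) unfolding trivial_fiber_bundle_iff bundle_trivialization_def
    by (intro exI[of _ h]) (simp add: h_def)
qed

end

theorem corollary4p8:
  fixes B :: "'b topology" and E :: "'e topology" and F :: "'f topology"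
    and p :: "'e \<Rightarrow> 'b"
  assumes "Alexandroff_space B"
    and "topspace B \<noteq> {}"
    and "simply_connected_space B"
    and "fiber_bundle E B F p"
  shows "trivial_fiber_bundle E B F p"
proof -
  interpret Alexandroff_fiber_bundle E B F p
    using assms by unfold_locales
  interpret frames: local_system B "\<lambda>x. frames x // frame_rel x" transport
    by (rule local_system_frames)
  obtain b0 where b0: "b0 \<in> topspace B" using assms(2) by blast
  obtain k0 where "triv b0 k0" using triv_exists[OF b0] .
  then have "frame_class b0 k0 \<in> frames b0 // frame_rel b0"
    using frame_class_in[OF b0 _ in_min_nbhd] by blast
  then obtain s where s: "\<And>b. b \<in> topspace B \<Longrightarrow> s b \<in> frames b // frame_rel b"
    "\<And>b x. b \<in> topspace B \<Longrightarrow> x \<in> U b \<Longrightarrow> s x = transport b x (s b)"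
    using frames.global_section[OF assms(3) b0] by metis
  have "\<exists>g. g \<in> frames b \<and> s b = frame_rel b `` {g}" if "b \<in> topspace B" for b
    using s(1)[OF that] by (auto elim: quotientE)
  then obtain f where f: "\<And>b. b \<in> topspace B \<Longrightarrow> f b \<in> frames b \<and> s b = frame_rel b `` {f b}"
    by metis
  show ?thesis
  proof (rule trivial_if_compatible_frames)
    show "f x \<in> frames x" if "x \<in> topspace B" for x
      using f[OF that] by blast
    fix b assume b: "b \<in> topspace B"
    obtain k where k: "triv b k" "s b = frame_class b k"
      using triv_representative[OF b in_min_nbhd s(1)[OF b]] .
    have "indist (k (x, v)) (f x v)" if x: "x \<in> U b" and v: "v \<in> topspace F" for x v
    proof -
      have xB: "x \<in> topspace B" using U_topspace[OF b] x by auto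
      \<comment> \<open>Both sides equal \<open>s x\<close>: the left one because \<open>k\<close>
        computes the transport of \<open>s b\<close>, the right one by the choice of
        \<open>f x\<close>.\<close>
      have "frame_rel x `` {\<lambda>v. k (x, v)} = frame_rel x `` {f x}"
        using s(2)[OF b x] transport_frame_class[OF b k(1) x] f[OF xB]
        by (simp add: k(2) frame_class_def)
      then have "(\<lambda>v. k (x, v), f x) \<in> frame_rel x"
        using eq_equiv_class[OF _ equiv_frame_rel] f[OF xB] by blast
      then show ?thesis using v by (simp add: frame_rel_def)
    qed
    then show "\<exists>k. triv b k \<and> (\<forall>x\<in>U b. \<forall>v\<in>topspace F. indist (k (x, v)) (f x v))"
      using k(1) by blast
  qed
qed

end
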